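(* Every triangle-free graph $G$ satisfies $\varphi(G)\ge \chi(G)-2$.
   Context: All graphs are finite, simple, undirected and non-empty. A proper colouring of $G$ assigns colours to vertices so that no edge is monochromatic; $\mathscr{C}(G)$ is the set of proper colourings of $G$. For a proper colouring $\sigma$, the discrepancy of $\sigma$ is $\varphi_\sigma(G)=\max_{H}\big(|\sigma(V(H))|-\chi(H)\big)$, the maximum over all induced subgraphs $H$ of $G$, where $\chi$ denotes chromatic number. The chromatic discrepancy of $G$ is $\varphi(G)=\min_{\sigma\in\mathscr{C}(G)}\varphi_\sigma(G)$. *)

theory Defs
  imports "Graph_Theory.Digraph_Component"
begin

text \<open>
  The locale \<^locale>\<open>graph\<close> describes finite simple undirected graphs: each undirected edge
  is a pair of opposite arcs, and there are no loops and no parallel arcs. It admits the null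
  graph, so non-emptiness is stated separately.
\<close>

definition triangle_free :: "('a, 'b) pre_digraph \<Rightarrow> bool" where
  "triangle_free G \<longleftrightarrow> \<not> (\<exists>u v w. u \<rightarrow>\<^bsub>G\<^esub> v \<and> v \<rightarrow>\<^bsub>G\<^esub> w \<and> w \<rightarrow>\<^bsub>G\<^esub> u)"

text \<open>
  Natural numbers suffice as colours because graphs are finite. The number of colours is not
  restricted, and the values of a colouring outside the vertex set are irrelevant.
\<close>

definition proper_colourings :: "('a, 'b) pre_digraph \<Rightarrow> ('a \<Rightarrow> nat) set" where
  "proper_colourings G = {\<sigma>. \<forall>u v. u \<rightarrow>\<^bsub>G\<^esub> v \<longrightarrow> \<sigma> u \<noteq> \<sigma> v}"

definition chromatic_number :: "('a, 'b) pre_digraph \<Rightarrow> nat" where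
  "chromatic_number G = (LEAST k. \<exists>\<sigma>\<in>proper_colourings G. card (\<sigma> ` verts G) = k)"

definition colouring_discrepancy :: "('a \<Rightarrow> nat) \<Rightarrow> ('a, 'b) pre_digraph \<Rightarrow> int" where
  "colouring_discrepancy \<sigma> G =
    Max {int (card (\<sigma> ` verts H)) - int (chromatic_number H) | H.
      induced_subgraph H G \<and> verts H \<noteq> {}}"

definition chromatic_discrepancy :: "('a, 'b) pre_digraph \<Rightarrow> int" where
  "chromatic_discrepancy G = Min {colouring_discrepancy \<sigma> G | \<sigma>. \<sigma> \<in> proper_colourings G}"

text \<open>
  The sets in the maxima and minima above are finite and non-empty, so that
  \<^const>\<open>Max\<close> and \<^const>\<open>Min\<close> are genuine extrema.
\<close>

lemma (in graph) proper_colourings_nonempty: "proper_colourings G \<noteq> {}"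
proof -
  obtain f :: "'a \<Rightarrow> nat" where f: "inj_on f (verts G)"
    using finite_imp_inj_to_nat_seg[OF finite_verts] by blast
  have "f u \<noteq> f v" if d: "u \<rightarrow>\<^bsub>G\<^esub> v" for u v
  proof -
    have "u \<in> verts G" "v \<in> verts G" using d by (auto dest: adj_in_verts)
    moreover have "u \<noteq> v" using d adj_not_same by blast
    ultimately show ?thesis using f by (auto dest: inj_onD)
  qed
  then show ?thesis by (auto simp: proper_colourings_def)
qed

lemma (in graph) discrepancy_values:
  fixes \<sigma> :: "'a \<Rightarrow> nat"
  assumes "verts G \<noteq> {}"
  shows "{int (card (\<sigma> ` verts H)) - int (chromatic_number H) | H.
      induced_subgraph H G \<and> verts H \<noteq> {}} \<noteq> {}" (is "?S \<noteq> {}")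
    and "finite {int (card (\<sigma> ` verts H)) - int (chromatic_number H) | H.
      induced_subgraph H G \<and> verts H \<noteq> {}}"
    and "{int (card (\<sigma> ` verts H)) - int (chromatic_number H) | H.
      induced_subgraph H G \<and> verts H \<noteq> {}} \<subseteq> {- int (card (verts G))..int (card (verts G))}"
proof -
  show "?S \<noteq> {}" using assms induced_subgraph_refl by blast
  have "?S \<subseteq> {- int (card (verts G))..int (card (verts G))}"
  proof
    fix x assume "x \<in> ?S"
    then obtain H where H: "induced_subgraph H G"
      and x: "x = int (card (\<sigma> ` verts H)) - int (chromatic_number H)" by blast
    interpret H: graph H using induced_graph_imp_graph H digraphI_induced
      by (metis graph_def pseudo_graph_def digraph_def)
    have sub: "verts H \<subseteq> verts G" using H by auto
    have le: "card (\<tau> ` verts H) \<le> card (verts G)" for \<tau> :: "'a \<Rightarrow> nat"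
      using card_image_le[OF H.finite_verts, of \<tau>] card_mono[OF finite_verts sub] by linarith
    obtain \<tau> where "\<tau> \<in> proper_colourings H" using H.proper_colourings_nonempty by blast
    then have "chromatic_number H \<le> card (\<tau> ` verts H)"
      unfolding chromatic_number_def by (intro Least_le) blast
    then show "x \<in> {- int (card (verts G))..int (card (verts G))}"
      using le[of \<tau>] le[of \<sigma>] x by auto
  qed
  then show "?S \<subseteq> {- int (card (verts G))..int (card (verts G))}" .
  then show "finite ?S" by (rule finite_subset) simp
qed

lemma (in graph) colouring_discrepancy_values:
  assumes "verts G \<noteq> {}"
  shows "{colouring_discrepancy \<sigma> G | \<sigma>. \<sigma> \<in> proper_colourings G} \<noteq> {}"
    and "finite {colouring_discrepancy \<sigma> G | \<sigma>. \<sigma> \<in> proper_colourings G}"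
proof -
  show "{colouring_discrepancy \<sigma> G | \<sigma>. \<sigma> \<in> proper_colourings G} \<noteq> {}"
    using proper_colourings_nonempty by blast
  have "colouring_discrepancy \<sigma> G \<in> {- int (card (verts G))..int (card (verts G))}" for \<sigma>
    using Max_in[OF discrepancy_values(2,1)[OF assms, of \<sigma>]]
      discrepancy_values(3)[OF assms, of \<sigma>]
    unfolding colouring_discrepancy_def by blast
  then have "{colouring_discrepancy \<sigma> G | \<sigma>. \<sigma> \<in> proper_colourings G}
      \<subseteq> {- int (card (verts G))..int (card (verts G))}" by blast
  then show "finite {colouring_discrepancy \<sigma> G | \<sigma>. \<sigma> \<in> proper_colourings G}"
    by (rule finite_subset) simp
qed

end

theory Submission
  imports Defs
begin

text \<open>
  Fix a proper colouring \<open>\<sigma>\<close> and write \<open>A v\<close> for the set of colours on the neighbours of \<open>v\<close>.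
  Greedily pick vertices \<open>v\<^sub>1, v\<^sub>2, \<dots>\<close>, each seeing a maximal number \<open>s\<^sub>i\<close> of
  colours outside \<open>A v\<^sub>1 \<union> \<dots> \<union> A v\<^sub>i\<^sub>-\<^sub>1\<close>. In a triangle-free graph neighbourhoods
  are independent, so \<open>t\<close> of them span a subgraph that is \<open>t\<close>-colourable and carries
  \<open>\<Sum> s\<^sub>i\<close> colours. Conversely \<open>\<chi> \<le> 2 + \<Sum> (s\<^sub>i - 1)\<close>: going backwards, the \<open>s\<^sub>i\<close> new
  colour classes cost only \<open>s\<^sub>i - 1\<close> colours, because one class of the colouring built so far can
  be dissolved. Each of its vertices either misses one of the new colours, or by maximality
  of \<open>s\<^sub>i\<close> it has no neighbour among the vertices coloured so far.
\<close>

text \<open>Stated for vertex sets of the fixed graph \<open>G\<close>, so that the induction can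
  unite sets without building subgraphs. Colours are the numbers below \<open>n\<close>, so new
  classes can take the next names.\<close>

definition colourable :: "('a, 'b) pre_digraph \<Rightarrow> 'a set \<Rightarrow> nat \<Rightarrow> bool" where
  "colourable G X n \<longleftrightarrow>
    (\<exists>\<tau> :: 'a \<Rightarrow> nat. (\<forall>x\<in>X. \<tau> x < n) \<and> (\<forall>x\<in>X. \<forall>y\<in>X. x \<rightarrow>\<^bsub>G\<^esub> y \<longrightarrow> \<tau> x \<noteq> \<tau> y))"

lemma chromatic_number_le:
  assumes "colourable G (verts H) n" "induced_subgraph H G"
  shows "chromatic_number H \<le> n"
proof -
  from assms(1) obtain \<tau> :: "'a \<Rightarrow> nat" where lt: "\<forall>x\<in>verts H. \<tau> x < n"
    and ne: "\<forall>x\<in>verts H. \<forall>y\<in>verts H. x \<rightarrow>\<^bsub>G\<^esub> y \<longrightarrow> \<tau> x \<noteq> \<tau> y"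
    unfolding colourable_def by blast
  have sub: "subgraph H G" using assms(2) by auto
  then interpret H: wf_digraph H by auto
  have "\<tau> u \<noteq> \<tau> v" if "u \<rightarrow>\<^bsub>H\<^esub> v" for u v
    using that ne H.adj_in_verts[OF that] pre_digraph.adj_mono[OF that sub] by blast
  then have "\<tau> \<in> proper_colourings H" by (auto simp: proper_colourings_def)
  then have "chromatic_number H \<le> card (\<tau> ` verts H)"
    unfolding chromatic_number_def by (intro Least_le) blast
  also have "\<dots> \<le> card {..<n}" using lt by (intro card_mono) auto
  finally show ?thesis by simp
qed

lemma colourable_Un_independent:
  assumes "colourable G X n" "\<forall>x\<in>Y. \<forall>y\<in>Y. \<not> x \<rightarrow>\<^bsub>G\<^esub> y"
  shows "colourable G (X \<union> Y) (Suc n)"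
proof -
  from assms(1) obtain \<tau> :: "'a \<Rightarrow> nat" where lt: "\<forall>x\<in>X. \<tau> x < n"
    and ne: "\<forall>x\<in>X. \<forall>y\<in>X. x \<rightarrow>\<^bsub>G\<^esub> y \<longrightarrow> \<tau> x \<noteq> \<tau> y"
    unfolding colourable_def by blast
  show ?thesis unfolding colourable_def
    by (rule exI[of _ "\<lambda>x. if x \<in> Y then n else \<tau> x"])
      (use lt ne assms(2) in \<open>auto simp: less_Suc_eq\<close>)
qed

definition seen_colours :: "('a, 'b) pre_digraph \<Rightarrow> ('a \<Rightarrow> nat) \<Rightarrow> 'a \<Rightarrow> nat set" where
  "seen_colours G \<sigma> v = \<sigma> ` {u. v \<rightarrow>\<^bsub>G\<^esub> u}"

text \<open>The \<open>card C\<close> new classes cost only \<open>card C - 1\<close> colours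
  because the old top class \<open>Suc k\<close> is dissolved and its name reused.\<close>

lemma (in graph) colourable_extend:
  fixes \<sigma> :: "'a \<Rightarrow> nat"
  assumes \<sigma>: "\<sigma> \<in> proper_colourings G"
    and fin: "finite R" and CR: "C \<subseteq> R" and C: "C \<noteq> {}"
    and max: "\<And>x. card (seen_colours G \<sigma> x \<inter> R) \<le> card C"
    and col: "colourable G {x \<in> verts G. \<sigma> x \<in> R - C} (Suc (Suc k))"
  shows "colourable G {x \<in> verts G. \<sigma> x \<in> R} (Suc k + card C)"
proof -
  have finC: "finite C" using fin CR by (rule rev_finite_subset)
  obtain f where f: "bij_betw f C {0..<card C}"
    using ex_bij_betw_finite_nat[OF finC] by blast
  have f_lt: "f c < card C" if "c \<in> C" for c using f that by (auto simp: bij_betw_def)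
  have f_inj: "f c \<noteq> f d" if "c \<in> C" "d \<in> C" "c \<noteq> d" for c d
    using f that by (auto simp: bij_betw_def inj_on_def)
  from col obtain \<tau> :: "'a \<Rightarrow> nat"
    where lt: "\<And>x. x \<in> verts G \<Longrightarrow> \<sigma> x \<in> R - C \<Longrightarrow> \<tau> x < Suc (Suc k)"
    and ne: "\<And>x y. x \<rightarrow> y \<Longrightarrow> \<sigma> x \<in> R - C \<Longrightarrow> \<sigma> y \<in> R - C \<Longrightarrow> \<tau> x \<noteq> \<tau> y"
    unfolding colourable_def by (metis (mono_tags, lifting) adj_in_verts mem_Collect_eq)
  define miss where "miss x = (SOME c. c \<in> C \<and> c \<notin> seen_colours G \<sigma> x)" for x
  have miss: "miss x \<in> C \<and> miss x \<notin> seen_colours G \<sigma> x" if "\<not> C \<subseteq> seen_colours G \<sigma> x" for x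
    unfolding miss_def by (rule someI_ex) (use that in blast)
  \<comment> \<open>Such a neighbour would let \<open>x\<close> see \<open>card C + 1\<close>
    colours of \<open>R\<close>, against \<open>max\<close>.\<close>
  have isolated: "\<sigma> y \<notin> R - C" if "C \<subseteq> seen_colours G \<sigma> x" "x \<rightarrow> y" for x y
  proof
    assume y: "\<sigma> y \<in> R - C"
    have "insert (\<sigma> y) C \<subseteq> seen_colours G \<sigma> x \<inter> R"
      using that y CR by (auto simp: seen_colours_def)
    then have "card (insert (\<sigma> y) C) \<le> card C"
      using max[of x] card_mono[of "seen_colours G \<sigma> x \<inter> R"] fin by (meson finite_Int order_trans)
    then show False using y finC by simp
  qed
  \<comment> \<open>Classes of \<open>C\<close> get names from \<open>Suc k\<close> upwards. A
    vertex of the dissolved class joins a class of \<open>C\<close> that it does not see, or falls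
    back on \<open>0\<close> if it sees all of \<open>C\<close>. As the old palette has at least two
    colours, \<open>0\<close> survives the dissolution.\<close>
  define \<rho> where "\<rho> x =
    (if \<sigma> x \<in> C then Suc k + f (\<sigma> x)
     else if \<tau> x \<le> k then \<tau> x
     else if C \<subseteq> seen_colours G \<sigma> x then 0
     else Suc k + f (miss x))" for x
  have "\<rho> x < Suc k + card C" if "x \<in> verts G" "\<sigma> x \<in> R" for x
    using miss[of x] f_lt[of "miss x"] f_lt[of "\<sigma> x"] by (auto simp: \<rho>_def)
  moreover have "\<rho> x \<noteq> \<rho> y" if adj: "x \<rightarrow> y" and R: "\<sigma> x \<in> R" "\<sigma> y \<in> R" for x y
  proof -
    have adj': "y \<rightarrow> x" using adj graph_symmetric by blast
    have neq: "\<sigma> x \<noteq> \<sigma> y" using \<sigma> adj by (auto simp: proper_colourings_def)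
    have seen: "\<sigma> x \<in> seen_colours G \<sigma> y" "\<sigma> y \<in> seen_colours G \<sigma> x"
      using adj adj' by (auto simp: seen_colours_def)
    \<comment> \<open>The new colour of \<open>u\<close> exceeds \<open>k\<close>. Only a vertex
      \<open>v\<close> moved into a class of \<open>C\<close> could share it, but \<open>v\<close>
      sees \<open>\<sigma> u\<close> and does not see \<open>miss v\<close>.\<close>
    have C_only: "\<rho> u \<noteq> \<rho> v" if "\<sigma> u \<in> C" "\<sigma> v \<notin> C" "\<sigma> u \<in> seen_colours G \<sigma> v" for u v
    proof (cases "C \<subseteq> seen_colours G \<sigma> v")
      case False
      then have "f (\<sigma> u) \<noteq> f (miss v)" using that miss[OF False] by (intro f_inj) auto
      then show ?thesis using that by (auto simp: \<rho>_def)
    qed (use that in \<open>auto simp: \<rho>_def\<close>)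
    \<comment> \<open>By \<open>isolated\<close>, the neighbour \<open>u\<close> prevents
      \<open>v\<close> from being sent to \<open>0\<close>; so \<open>v\<close> keeps its old colour
      or moves above \<open>k\<close>.\<close>
    have not_C: "\<rho> u \<noteq> \<rho> v"
      if "u \<rightarrow> v" "v \<rightarrow> u" "\<sigma> u \<in> R - C" "\<sigma> v \<in> R - C" "\<tau> u \<le> k" for u v
      using that isolated[of v u] ne[of u v] by (auto simp: \<rho>_def)
    show ?thesis
    proof (cases "\<sigma> x \<in> C"; cases "\<sigma> y \<in> C")
      assume "\<sigma> x \<in> C" "\<sigma> y \<in> C"
      then show ?thesis using f_inj neq by (simp add: \<rho>_def)
    next
      assume "\<sigma> x \<in> C" "\<sigma> y \<notin> C"
      then show ?thesis using C_only seen by blast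
    next
      assume "\<sigma> x \<notin> C" "\<sigma> y \<in> C"
      then show ?thesis using C_only seen by metis
    next
      assume nC: "\<sigma> x \<notin> C" "\<sigma> y \<notin> C"
      then have "\<tau> x \<noteq> \<tau> y" using ne adj R by blast
      moreover have "\<tau> x < Suc (Suc k)" "\<tau> y < Suc (Suc k)"
        using lt nC R adj_in_verts[OF adj] by auto
      \<comment> \<open>The dissolved class is independent, so at least one endpoint keeps its old
        colour.\<close>
      ultimately have "\<tau> x \<le> k \<or> \<tau> y \<le> k" by linarith
      then show ?thesis using not_C[of x y] not_C[of y x] adj adj' nC R by auto
    qed
  qed
  ultimately show ?thesis unfolding colourable_def by blast
qed

text \<open>\<open>R\<close> holds the colours still unclaimed and \<open>h\<close> counts the
  neighbourhoods making up \<open>H\<close>. Each round raises \<open>k\<close> by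
  \<open>card C - 1\<close>, both as the surplus of colours on \<open>H\<close> over
  \<open>h\<close> and as the number of colours spent beyond two.\<close>

lemma (in graph) discrepant_subset_exists:
  fixes \<sigma> :: "'a \<Rightarrow> nat"
  assumes tf: "triangle_free G" and \<sigma>: "\<sigma> \<in> proper_colourings G" and "finite R"
  shows "\<exists>H h k. H \<subseteq> {x \<in> verts G. \<sigma> x \<in> R} \<and> colourable G H h \<and>
    colourable G {x \<in> verts G. \<sigma> x \<in> R} (k + 2) \<and> card (\<sigma> ` H) = k + h"
  using \<open>finite R\<close>
proof (induction R rule: finite_psubset_induct)
  case (psubset R)
  let ?S = "\<lambda>x. seen_colours G \<sigma> x \<inter> R"
  have sym: "y \<rightarrow> x" if "x \<rightarrow> y" for x y
    using that graph_symmetric by blast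
  show ?case
  proof (cases "\<exists>v. ?S v \<noteq> {}")
    case False
    then have no_edge: "\<not> x \<rightarrow> y" if "\<sigma> y \<in> R" for x y
      using that by (auto simp: seen_colours_def)
    \<comment> \<open>These vertices are independent; the bound is nevertheless two because
      \<open>colourable_extend\<close> must keep a colour after dissolving a class.\<close>
    have "colourable G {x \<in> verts G. \<sigma> x \<in> R} (0 + 2)"
      unfolding colourable_def by (rule exI[of _ "\<lambda>_. 0"]) (auto simp: no_edge)
    moreover have "colourable G {} 0" by (simp add: colourable_def)
    ultimately show ?thesis by (intro exI[of _ "{}"] exI[of _ "0::nat"]) auto
  next
    case True
    \<comment> \<open>A uniform bound yields a maximising \<open>v\<close> even when the vertex type
      is infinite.\<close>
    have "card (?S x) < Suc (card R)" for x
      using psubset.hyps by (simp add: card_mono less_Suc_eq_le)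
    then obtain v where v: "\<And>x. card (?S x) \<le> card (?S v)"
      using ex_has_greatest_nat[of "\<lambda>_. True" _ "\<lambda>x. card (?S x)" "Suc (card R)"] by blast
    define C where "C = ?S v"
    have finC: "finite C" and CR: "C \<subseteq> R" using psubset.hyps by (auto simp: C_def)
    obtain u where "?S u \<noteq> {}" using True by blast
    then have "card (?S u) > 0" using psubset.hyps by (simp add: card_gt_0_iff)
    then have "card C > 0" using v[of u] by (simp add: C_def)
    then have C: "C \<noteq> {}" by auto
    then have "R - C \<subset> R" using CR by auto
    from psubset.IH[OF this] obtain H h k
      where H: "H \<subseteq> {x \<in> verts G. \<sigma> x \<in> R - C}" "colourable G H h"
        and k: "colourable G {x \<in> verts G. \<sigma> x \<in> R - C} (k + 2)" and card: "card (\<sigma> ` H) = k + h"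
      by blast
    define N where "N = {u. v \<rightarrow> u \<and> \<sigma> u \<in> R}"
    have N: "\<not> x \<rightarrow> y" if "x \<in> N" "y \<in> N" for x y
      using that tf sym unfolding N_def triangle_free_def by blast
    have \<sigma>N: "\<sigma> ` N = C" by (auto simp: N_def C_def seen_colours_def)
    have "colourable G (H \<union> N) (Suc h)" using colourable_Un_independent[OF H(2)] N by blast
    moreover have "H \<union> N \<subseteq> {x \<in> verts G. \<sigma> x \<in> R}"
      using H(1) by (auto simp: N_def dest: adj_in_verts)
    moreover have "colourable G {x \<in> verts G. \<sigma> x \<in> R} ((k + card C - 1) + 2)"
      using colourable_extend[OF \<sigma> psubset.hyps CR C, of k] v k \<open>card C > 0\<close>
      by (simp add: C_def)
    moreover have "card (\<sigma> ` (H \<union> N)) = (k + card C - 1) + Suc h"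
    proof -
      have "finite (\<sigma> ` H)" using H(1) by (intro finite_imageI finite_subset[OF _ finite_verts]) auto
      moreover have "\<sigma> ` H \<inter> C = {}" using H(1) by auto
      ultimately have "card (\<sigma> ` H \<union> C) = k + h + card C"
        using card finC by (simp add: card_Un_disjoint)
      then show ?thesis using \<open>card C > 0\<close> by (simp add: image_Un \<sigma>N)
    qed
    ultimately show ?thesis by blast
  qed
qed

lemma (in graph) colouring_discrepancy_ge:
  assumes "X \<subseteq> verts G" "X \<noteq> {}" "colourable G X n"
  shows "colouring_discrepancy \<sigma> G \<ge> int (card (\<sigma> ` X)) - int n"
proof -
  let ?H = "G \<restriction> X"
  have ind: "induced_subgraph ?H G" using assms(1) by (rule induced_induce)
  have "chromatic_number ?H \<le> n" using chromatic_number_le[OF _ ind] assms(3) by simp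
  then have "int (card (\<sigma> ` X)) - int n \<le> int (card (\<sigma> ` verts ?H)) - int (chromatic_number ?H)"
    by simp
  also have "\<dots> \<le> colouring_discrepancy \<sigma> G"
    unfolding colouring_discrepancy_def
  proof (rule Max_ge)
    show "finite {int (card (\<sigma> ` verts H)) - int (chromatic_number H) | H.
      induced_subgraph H G \<and> verts H \<noteq> {}}"
      using assms(1,2) by (intro discrepancy_values(2)) auto
  qed (use ind assms(2) in \<open>auto intro!: exI[of _ ?H]\<close>)
  finally show ?thesis .
qed

theorem theorem1p2:
  fixes G :: "('a, 'b) pre_digraph"
  assumes "graph G"
    and "verts G \<noteq> {}"
    and "triangle_free G"
  shows "chromatic_discrepancy G \<ge> int (chromatic_number G) - 2"
proof -
  interpret graph G by fact
  have "int (chromatic_number G) - 2 \<le> colouring_discrepancy \<sigma> G"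
    if \<sigma>: "\<sigma> \<in> proper_colourings G" for \<sigma>
  proof -
    have "{x \<in> verts G. \<sigma> x \<in> \<sigma> ` verts G} = verts G" by auto
    then obtain H h k where H: "H \<subseteq> verts G" "colourable G H h"
      and k: "colourable G (verts G) (k + 2)" and card: "card (\<sigma> ` H) = k + h"
      using discrepant_subset_exists[OF assms(3) \<sigma>, of "\<sigma> ` verts G"] by auto
    have \<chi>: "chromatic_number G \<le> k + 2" using chromatic_number_le[OF k induced_subgraph_refl] .
    show ?thesis
    proof (cases "H = {}")
      \<comment> \<open>Here \<open>k = 0\<close>, so the target is at most zero. The discrepancy
        ranges over non-empty subgraphs only, so a single vertex replaces \<open>H\<close>.\<close>
      case True
      obtain v where v: "v \<in> verts G" using assms(2) by blast
      have "colourable G {v} 1"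
        unfolding colourable_def by (rule exI[of _ "\<lambda>_. 0"]) (auto dest: adj_not_same)
      then have "0 \<le> colouring_discrepancy \<sigma> G"
        using colouring_discrepancy_ge[of "{v}" 1 \<sigma>] v by simp
      then show ?thesis using \<chi> card True by simp
    next
      case False
      then show ?thesis using colouring_discrepancy_ge[OF H(1) False H(2), of \<sigma>] \<chi> card by simp
    qed
  qed
  then show ?thesis
    unfolding chromatic_discrepancy_def
    using colouring_discrepancy_values[OF assms(2)] by (subst Min_ge_iff) auto
qed

end
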